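(* Let $G$ be a fixed finite simple graph and let $\mathscr G=\{\mathscr G_n\}$ be any one of the following families: (GC) $\mathscr G_n=\{G\times P_n\}$, $n\ge1$; (GX) for a fixed subgraph $H\subseteq G$, $\mathscr G_n=\{X_n(G,H)\}$, $n\ge1$, where $X_n(G,H)$ is obtained from $G\sqcup(H\times P_n)$ by identifying $H\subseteq G$ with $H\times\{1\}$; (GT) $\mathscr G_n=\{G\times C_n\}$, $n\ge3$; (GE) for a fixed subgraph $H\subseteq G$, $\mathscr G_n=\{E_n(G,H)\}$, $n\ge3$, where $E_n(G,H)$ is obtained from $G\sqcup(H\times C_n)$ by identifying $H\subseteq G$ with $H\times\{1\}$; (GS1) for a fixed edge $e$, $\mathscr G_n=\{S_n(G,e)\}$, where $S_n(G,e)$ subdivides $e$ with $n$ new vertices; (GSm) for a fixed edge set $\{e_1,\dots,e_m\}$, $\mathscr G_n$ consists of the graphs obtained by subdividing each $e_k$ with $n_k\ge0$ new vertices, one for each tuple $(n_1,\dots,n_m)$ with $\sum n_k=n$. Then $\widetilde\Xi_{\mathscr G}=\sum_{n\ge1}\sum_{K\in\mathscr G_n}\widetilde W_K(b,w_-,w_+)\,x^n\in\mathbb{Z}[b,w_-,w_+][[x]]$ is a rational function in $x$ (with coefficients in $\mathbb{Z}[b,w_-,w_+]$).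
   Context: A coloring of a graph $K$ is a map $c\colon V(K)\to\{0,1\}$ ($0$ white, $1$ black). Partition $V(K)$ into $B(c)$ (black vertices), $W_+(c)$ (white vertices with an even number of black neighbors) and $W_-(c)$ (white vertices with an odd number of black neighbors). The full $W$-polynomial is $\widetilde W_K=\sum_c b^{|B(c)|}w_+^{|W_+(c)|}w_-^{|W_-(c)|}\in\mathbb{Z}[b,w_+,w_-]$. $P_n$, $C_n$ are the path and cycle graphs on vertex set $\{1,\dots,n\}$, and $K\times K'$ is the Cartesian (box) product: $(u,u')\sim(v,v')$ iff ($u'=v'$ and $u\sim v$) or ($u=v$ and $u'\sim v'$). *)

theory Defs
  imports
    "Graph_Theory.Graph_Theory"
    "HOL-Computational_Algebra.Polynomial_FPS"
    "HOL-Library.FuncSet"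
    "HOL-Library.Multiset"
begin

text \<open>
  Finite simple graphs are the locale predicate \<open>pair_graph\<close>: an edge between \<open>u\<close> and \<open>v\<close> is
  present as the two arcs \<open>(u, v)\<close> and \<open>(v, u)\<close>.
\<close>

section \<open>The full W-polynomial\<close>

text \<open>
  The ring of integer polynomials in the three variables \<open>b\<close>, \<open>w\<^sub>+\<close>, \<open>w\<^sub>-\<close>, as iterated
  univariate polynomials.
\<close>

type_synonym bw_poly = "int poly poly poly"

definition var_b :: bw_poly where
  "var_b = [:0, 1:]"

definition var_w_plus :: bw_poly where
  "var_w_plus = [:[:0, 1:]:]"

definition var_w_minus :: bw_poly where
  "var_w_minus = [:[:[:0, 1:]:]:]"

definition colorings :: "'v pair_pre_digraph \<Rightarrow> ('v \<Rightarrow> nat) set" where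
  "colorings K = pverts K \<rightarrow>\<^sub>E {0, 1}"

definition black :: "'v pair_pre_digraph \<Rightarrow> ('v \<Rightarrow> nat) \<Rightarrow> 'v set" where
  "black K c = {v \<in> pverts K. c v = 1}"

definition black_nbs :: "'v pair_pre_digraph \<Rightarrow> ('v \<Rightarrow> nat) \<Rightarrow> 'v \<Rightarrow> 'v set" where
  "black_nbs K c v = {u \<in> black K c. (v, u) \<in> parcs K}"

definition white_even :: "'v pair_pre_digraph \<Rightarrow> ('v \<Rightarrow> nat) \<Rightarrow> 'v set" where
  "white_even K c = {v \<in> pverts K. c v = 0 \<and> even (card (black_nbs K c v))}"

definition white_odd :: "'v pair_pre_digraph \<Rightarrow> ('v \<Rightarrow> nat) \<Rightarrow> 'v set" where
  "white_odd K c = {v \<in> pverts K. c v = 0 \<and> odd (card (black_nbs K c v))}"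

definition full_W :: "'v pair_pre_digraph \<Rightarrow> bw_poly" where
  "full_W K = (\<Sum>c\<in>colorings K.
     var_b ^ card (black K c) *
     var_w_plus ^ card (white_even K c) *
     var_w_minus ^ card (white_odd K c))"

section \<open>Graph constructions\<close>

definition path_graph :: "nat \<Rightarrow> nat pair_pre_digraph" where
  "path_graph n = \<lparr> pverts = {1..n},
     parcs = {(i, j). i \<in> {1..n} \<and> j \<in> {1..n} \<and> (j = i + 1 \<or> i = j + 1)} \<rparr>"

text \<open>Only used for \<open>n \<ge> 3\<close>; for \<open>n = 1\<close> this has a loop.\<close>

definition cycle_graph :: "nat \<Rightarrow> nat pair_pre_digraph" where
  "cycle_graph n = \<lparr> pverts = {1..n},
     parcs = {(i, j). i \<in> {1..n} \<and> j \<in> {1..n} \<and> (j = i mod n + 1 \<or> i = j mod n + 1)} \<rparr>"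

definition box_product ::
    "'a pair_pre_digraph \<Rightarrow> 'b pair_pre_digraph \<Rightarrow> ('a \<times> 'b) pair_pre_digraph" where
  "box_product K K' = \<lparr> pverts = pverts K \<times> pverts K',
     parcs = {((u, u'), (v, v')).
       u \<in> pverts K \<and> v \<in> pverts K \<and> u' \<in> pverts K' \<and> v' \<in> pverts K' \<and>
       (u' = v' \<and> (u, v) \<in> parcs K \<or> u = v \<and> (u', v') \<in> parcs K')} \<rparr>"

definition disjoint_sum ::
    "'a pair_pre_digraph \<Rightarrow> 'b pair_pre_digraph \<Rightarrow> ('a + 'b) pair_pre_digraph" where
  "disjoint_sum K K' = \<lparr> pverts = Inl ` pverts K \<union> Inr ` pverts K',
     parcs = map_prod Inl Inl ` parcs K \<union> map_prod Inr Inr ` parcs K' \<rparr>"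

text \<open>The graph obtained from \<open>K\<close> by identifying the vertices with the same image under \<open>f\<close>.\<close>

definition identify :: "('a \<Rightarrow> 'b) \<Rightarrow> 'a pair_pre_digraph \<Rightarrow> 'b pair_pre_digraph" where
  "identify f K = \<lparr> pverts = f ` pverts K, parcs = map_prod f f ` parcs K \<rparr>"

text \<open>
  In the disjoint sum of \<open>G\<close> with the product of \<open>H\<close> and a path or cycle, the identifying map
  sends \<open>Inl v\<close> to \<open>(v, 1)\<close> and \<open>Inr (h, i)\<close> to \<open>(h, i)\<close>. The only distinct vertices with a
  common image are \<open>Inl h\<close> and \<open>Inr (h, 1)\<close> for vertices \<open>h\<close> of \<open>H\<close>.
\<close>

definition graph_X ::
    "nat \<Rightarrow> 'a pair_pre_digraph \<Rightarrow> 'a pair_pre_digraph \<Rightarrow> ('a \<times> nat) pair_pre_digraph" where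
  "graph_X n G H =
     identify (case_sum (\<lambda>v. (v, 1)) (\<lambda>p. p)) (disjoint_sum G (box_product H (path_graph n)))"

definition graph_E ::
    "nat \<Rightarrow> 'a pair_pre_digraph \<Rightarrow> 'a pair_pre_digraph \<Rightarrow> ('a \<times> nat) pair_pre_digraph" where
  "graph_E n G H =
     identify (case_sum (\<lambda>v. (v, 1)) (\<lambda>p. p)) (disjoint_sum G (box_product H (cycle_graph n)))"

text \<open>
  Subdivision of the edges \<open>es ! k\<close> with \<open>ns ! k\<close> new vertices \<open>Inr (k, 1), \<dots>, Inr (k, ns ! k)\<close>.
  Each edge is given by one of its two arcs; \<open>subdiv_vertex es ns k i\<close> is the \<open>i\<close>-th vertex,
  \<open>0 \<le> i \<le> ns ! k + 1\<close>, of the path replacing the \<open>k\<close>-th edge.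
\<close>

definition subdiv_vertex ::
    "('a \<times> 'a) list \<Rightarrow> nat list \<Rightarrow> nat \<Rightarrow> nat \<Rightarrow> 'a + nat \<times> nat" where
  "subdiv_vertex es ns k i =
     (if i = 0 then Inl (fst (es ! k))
      else if i \<le> ns ! k then Inr (k, i)
      else Inl (snd (es ! k)))"

definition subdivide_edges ::
    "'a pair_pre_digraph \<Rightarrow> ('a \<times> 'a) list \<Rightarrow> nat list \<Rightarrow> ('a + nat \<times> nat) pair_pre_digraph" where
  "subdivide_edges G es ns = \<lparr>
     pverts = Inl ` pverts G \<union> {Inr (k, i) | k i. k < length es \<and> 1 \<le> i \<and> i \<le> ns ! k},
     parcs = {(Inl u, Inl v) | u v. (u, v) \<in> parcs G \<and> (u, v) \<notin> set es \<and> (v, u) \<notin> set es} \<union>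
       symcl {(subdiv_vertex es ns k i, subdiv_vertex es ns k (Suc i)) | k i.
         k < length es \<and> i \<le> ns ! k} \<rparr>"

section \<open>Families of graphs and their generating functions\<close>

text \<open>
  A family assigns to each \<open>n\<close> a finite multiset of graphs; it is empty at those \<open>n\<close> where the
  family is not defined.
\<close>

type_synonym 'v graph_family = "nat \<Rightarrow> 'v pair_pre_digraph multiset"

definition family_GC :: "'a pair_pre_digraph \<Rightarrow> ('a \<times> nat) graph_family" where
  "family_GC G n = (if 1 \<le> n then {#box_product G (path_graph n)#} else {#})"

definition family_GX ::
    "'a pair_pre_digraph \<Rightarrow> 'a pair_pre_digraph \<Rightarrow> ('a \<times> nat) graph_family" where
  "family_GX G H n = (if 1 \<le> n then {#graph_X n G H#} else {#})"

definition family_GT :: "'a pair_pre_digraph \<Rightarrow> ('a \<times> nat) graph_family" where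
  "family_GT G n = (if 3 \<le> n then {#box_product G (cycle_graph n)#} else {#})"

definition family_GE ::
    "'a pair_pre_digraph \<Rightarrow> 'a pair_pre_digraph \<Rightarrow> ('a \<times> nat) graph_family" where
  "family_GE G H n = (if 3 \<le> n then {#graph_E n G H#} else {#})"

definition family_GS1 :: "'a pair_pre_digraph \<Rightarrow> 'a \<times> 'a \<Rightarrow> ('a + nat \<times> nat) graph_family" where
  "family_GS1 G e n = {#subdivide_edges G [e] [n]#}"

definition family_GSm ::
    "'a pair_pre_digraph \<Rightarrow> ('a \<times> 'a) list \<Rightarrow> ('a + nat \<times> nat) graph_family" where
  "family_GSm G es n =
     image_mset (subdivide_edges G es) (mset_set {ns. length ns = length es \<and> sum_list ns = n})"

definition full_Xi :: "'v graph_family \<Rightarrow> bw_poly fps" where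
  "full_Xi \<G> = Abs_fps (\<lambda>n. if 1 \<le> n then \<Sum>K\<in>#\<G> n. full_W K else 0)"

definition rational_fps :: "'r::idom fps \<Rightarrow> bool" where
  "rational_fps F \<longleftrightarrow> (\<exists>p q. q \<noteq> 0 \<and> fps_of_poly q * F = fps_of_poly p)"

text \<open>
  The list \<open>es\<close> enumerates a set of edges of \<open>G\<close> without repetition, each edge being represented
  by one of its two arcs.
\<close>

definition edge_enumeration :: "'a pair_pre_digraph \<Rightarrow> ('a \<times> 'a) list \<Rightarrow> bool" where
  "edge_enumeration G es \<longleftrightarrow> set es \<subseteq> parcs G \<and> distinct (map (\<lambda>(u, v). {u, v}) es)"

end

theory Submission
  imports Defs
begin

text \<open>
  All the graphs in question consist of a fixed core together with one or several chains of
  copies of a fixed graph \<open>H\<close>, each chain being attached to the core at its two ends. The weight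
  of a black set is a product over the vertices, and the weight of an inner layer of a chain
  depends only on the black sets in that layer and in its two neighbours. The sum over all
  colorings of a chain is therefore computed by a transfer operator on functions of two
  consecutive layer states, and the finite linear system for its generating functions yields a
  linear recurrence in the length of the chain. This recurrence depends only on \<open>H\<close>, not on the
  core or the attaching edges, so for the family of simultaneous subdivisions it applies in every
  coordinate while the other path lengths stay fixed, and rationality of the multi-indexed sum
  follows by induction on the number of paths.
\<close>

unbundle fps_syntax

section \<open>Rational power series\<close>

lemma rational_fps_of_poly: "rational_fps (fps_of_poly p)"
  unfolding rational_fps_def by (rule exI[of _ p], rule exI[of _ 1]) simp

lemma rational_fps_add:
  assumes "rational_fps F" "rational_fps G"
  shows "rational_fps (F + G)"
proof -
  obtain p q p' q' where *: "q \<noteq> 0" "fps_of_poly q * F = fps_of_poly p"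
    "q' \<noteq> 0" "fps_of_poly q' * G = fps_of_poly p'"
    using assms unfolding rational_fps_def by blast
  have "fps_of_poly (q * q') * (F + G) =
      fps_of_poly q' * (fps_of_poly q * F) + fps_of_poly q * (fps_of_poly q' * G)"
    by (simp add: fps_of_poly_mult algebra_simps)
  also have "\<dots> = fps_of_poly (q' * p + q * p')"
    by (simp add: * fps_of_poly_mult fps_of_poly_add)
  finally show ?thesis
    using * unfolding rational_fps_def by (metis no_zero_divisors)
qed

lemma rational_fps_poly_mult:
  assumes "rational_fps F"
  shows "rational_fps (fps_of_poly p * F)"
proof -
  obtain r q where *: "q \<noteq> 0" "fps_of_poly q * F = fps_of_poly r"
    using assms unfolding rational_fps_def by blast
  have "fps_of_poly q * (fps_of_poly p * F) = fps_of_poly (p * r)"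
    by (simp add: * fps_of_poly_mult mult.left_commute[of "fps_of_poly q"])
  then show ?thesis
    using * unfolding rational_fps_def by blast
qed

lemma rational_fps_cancel:
  assumes "rational_fps (fps_of_poly q * F)" "q \<noteq> 0"
  shows "rational_fps F"
proof -
  obtain p r where *: "r \<noteq> 0" "fps_of_poly r * (fps_of_poly q * F) = fps_of_poly p"
    using assms unfolding rational_fps_def by blast
  then have "fps_of_poly (r * q) * F = fps_of_poly p"
    by (simp add: fps_of_poly_mult mult.assoc)
  then show ?thesis
    using * assms(2) unfolding rational_fps_def by (metis no_zero_divisors)
qed

lemma rational_fps_sum:
  assumes "\<And>i. i \<in> I \<Longrightarrow> rational_fps (F i)"
  shows "rational_fps (\<Sum>i\<in>I. F i)"
  using assms
proof (induction I rule: infinite_finite_induct)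
  case (insert i I)
  then show ?case by (simp add: rational_fps_add)
qed (use rational_fps_of_poly[of 0] in auto)

text \<open>The product of the denominators works. One polynomial for a whole finite family is
  needed later, for a recurrence shared by all layer states.\<close>

lemma rational_fps_common_denominator:
  assumes "finite I" "\<And>i. i \<in> I \<Longrightarrow> rational_fps (F i)"
  shows "\<exists>q. q \<noteq> 0 \<and> (\<forall>i\<in>I. \<exists>p. fps_of_poly q * F i = fps_of_poly p)"
  using assms
proof (induction I rule: finite_induct)
  case empty
  show ?case by (rule exI[of _ 1]) simp
next
  case (insert j I)
  obtain q where q: "q \<noteq> 0" "\<forall>i\<in>I. \<exists>p. fps_of_poly q * F i = fps_of_poly p"
    using insert by auto
  obtain r s where r: "r \<noteq> 0" "fps_of_poly r * F j = fps_of_poly s"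
    using insert unfolding rational_fps_def by blast
  have "\<exists>p. fps_of_poly (q * r) * F i = fps_of_poly p" if i: "i \<in> insert j I" for i
  proof (cases "i = j")
    case True
    have "fps_of_poly (q * r) * F j = fps_of_poly (q * s)"
      by (simp add: fps_of_poly_mult r mult.assoc)
    with True show ?thesis by blast
  next
    case False
    then obtain p where "fps_of_poly q * F i = fps_of_poly p"
      using bspec[OF q(2), of i] i by auto
    moreover have "fps_of_poly (q * r) * F i = fps_of_poly r * (fps_of_poly q * F i)"
      by (simp add: fps_of_poly_mult algebra_simps)
    ultimately have "fps_of_poly (q * r) * F i = fps_of_poly (r * p)"
      by (simp add: fps_of_poly_mult)
    then show ?thesis by blast
  qed
  with q r show ?case by (intro exI[of _ "q * r"]) auto
qed

text \<open>
  Gaussian elimination without divisions: the pivots stay nonzero because they have constant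
  coefficient \<open>1\<close>.
\<close>

lemma rational_fps_linear_system:
  fixes F :: "'s \<Rightarrow> 'r::idom fps"
  assumes "finite I" "\<And>s. s \<in> I \<Longrightarrow> poly (q s) 0 = 1"
    and "\<And>s t. s \<in> I \<Longrightarrow> t \<in> I \<Longrightarrow> poly (a s t) 0 = 0"
    and "\<And>s. s \<in> I \<Longrightarrow> fps_of_poly (q s) * F s =
           fps_of_poly (p s) + (\<Sum>t\<in>I. fps_of_poly (a s t) * F t)"
    and "s \<in> I"
  shows "rational_fps (F s)"
  using assms
proof (induction I arbitrary: q a p s rule: finite_induct)
  case empty
  then show ?case by simp
next
  case (insert v I)
  let ?f = fps_of_poly
  \<comment> \<open>The pivot: the coefficient of \<open>F v\<close> after its diagonal term has
    moved to the left.\<close>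
  define r where "r = q v - a v v"
  have r0: "poly r 0 = 1" using insert.prems by (simp add: r_def)
  then have r_nz: "r \<noteq> 0" by auto
  have v: "?f r * F v = ?f (p v) + (\<Sum>t\<in>I. ?f (a v t) * F t)"
    using insert.prems(3)[of v] insert.hyps
    by (simp add: r_def fps_of_poly_diff algebra_simps)
  \<comment> \<open>Multiply equation \<open>u\<close> by the pivot and replace
    \<open>r * F v\<close> by the right side of \<open>v\<close>. The left coefficients become
    \<open>q u * r\<close>, which is why the lemma admits a general \<open>q\<close> instead of
    \<open>1\<close>.\<close>
  have rat: "rational_fps (F u)" if "u \<in> I" for u
  proof (rule insert.IH[of "\<lambda>u. q u * r" "\<lambda>u t. r * a u t + a u v * a v t"
        "\<lambda>u. r * p u + a u v * p v"])
    fix u assume u: "u \<in> I"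
    have "?f (q u * r) * F u = ?f r * (?f (q u) * F u)"
      by (simp add: fps_of_poly_mult algebra_simps)
    also have "\<dots> = ?f r * (?f (p u) + (\<Sum>t\<in>I. ?f (a u t) * F t)) + ?f (a u v) * (?f r * F v)"
      using insert.prems(3)[of u] insert.hyps u by (simp add: algebra_simps)
    also have "\<dots> = ?f (r * p u + a u v * p v) + (\<Sum>t\<in>I. ?f (r * a u t + a u v * a v t) * F t)"
      unfolding v
      by (simp add: fps_of_poly_mult fps_of_poly_add algebra_simps sum_distrib_left sum.distrib)
    finally show "?f (q u * r) * F u = ?f (r * p u + a u v * p v) +
        (\<Sum>t\<in>I. ?f (r * a u t + a u v * a v t) * F t)" .
  qed (use insert.prems r0 that in auto)
  have "rational_fps (F v)"
    by (rule rational_fps_cancel[of r, OF _ r_nz], unfold v)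
      (intro rational_fps_add rational_fps_of_poly rational_fps_sum rational_fps_poly_mult rat)
  with rat insert.prems show ?case by auto
qed

section \<open>Linear recurrences\<close>

text \<open>Equivalently, \<open>q\<close> times the generating function of \<open>f\<close> has no
  terms from degree \<open>N\<close> on. The explicit threshold lets one pair \<open>q\<close>,
  \<open>N\<close> serve many sequences.\<close>

definition annihilates :: "'r::idom poly \<Rightarrow> nat \<Rightarrow> (nat \<Rightarrow> 'r) \<Rightarrow> bool" where
  "annihilates q N f \<longleftrightarrow> (\<forall>n\<ge>N. (\<Sum>i\<le>n. coeff q i * f (n - i)) = 0)"

lemma annihilates_sum:
  assumes "\<And>i. i \<in> I \<Longrightarrow> annihilates q N (f i)"
  shows "annihilates q N (\<lambda>n. \<Sum>i\<in>I. f i n)"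
  unfolding annihilates_def
proof (intro allI impI)
  fix n assume n: "N \<le> n"
  have "(\<Sum>j\<le>n. coeff q j * (\<Sum>i\<in>I. f i (n - j))) =
      (\<Sum>i\<in>I. \<Sum>j\<le>n. coeff q j * f i (n - j))"
    unfolding sum_distrib_left by (rule sum.swap)
  also have "\<dots> = 0"
    using assms n by (intro sum.neutral) (simp add: annihilates_def)
  finally show "(\<Sum>j\<le>n. coeff q j * (\<Sum>i\<in>I. f i (n - j))) = 0" .
qed

lemma annihilates_mult:
  assumes "annihilates q N f"
  shows "annihilates q N (\<lambda>n. c * f n)"
  using assms unfolding annihilates_def
  by (simp add: mult.left_commute[of _ c] sum_distrib_left[symmetric])

text \<open>For large \<open>n\<close>, the terms reaching below index \<open>c\<close> carry
  coefficients of \<open>q\<close> beyond its degree, so the initial values of \<open>f\<close> only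
  delay the start of the recurrence.\<close>

lemma annihilates_shift:
  assumes "annihilates q N (\<lambda>n. f (n + c))"
  shows "annihilates q (N + c + degree q) f"
  unfolding annihilates_def
proof (intro allI impI)
  fix n assume n: "N + c + degree q \<le> n"
  have "(\<Sum>i\<le>n. coeff q i * f (n - i)) = (\<Sum>i\<le>n - c. coeff q i * f (n - i))"
    using n by (intro sum.mono_neutral_right) (auto simp: coeff_eq_0)
  also have "\<dots> = (\<Sum>i\<le>n - c. coeff q i * f (n - c - i + c))"
    using n by (intro sum.cong) auto
  also have "\<dots> = 0"
    using assms n unfolding annihilates_def by (elim allE[of _ "n - c"]) simp
  finally show "(\<Sum>i\<le>n. coeff q i * f (n - i)) = 0" .
qed

lemma fps_of_poly_mult_nth:
  "(fps_of_poly q * F) $ n = (\<Sum>i\<le>n. coeff q i * F $ (n - i))"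
  by (simp add: fps_mult_nth atLeast0AtMost)

lemma rational_fps_common_annihilator:
  assumes "finite I" "\<And>i. i \<in> I \<Longrightarrow> rational_fps (Abs_fps (f i))"
  shows "\<exists>q N. q \<noteq> 0 \<and> (\<forall>i\<in>I. annihilates q N (f i))"
proof -
  obtain q where q: "q \<noteq> 0" "\<forall>i\<in>I. \<exists>p. fps_of_poly q * Abs_fps (f i) = fps_of_poly p"
    using rational_fps_common_denominator[of I "\<lambda>i. Abs_fps (f i)"] assms by auto
  from bchoice[OF q(2)] obtain p
    where p: "\<And>i. i \<in> I \<Longrightarrow> fps_of_poly q * Abs_fps (f i) = fps_of_poly (p i)" by auto
  \<comment> \<open>The sum of the degrees bounds each of them, which gives a common
    threshold.\<close>
  have "annihilates q (Suc (\<Sum>i\<in>I. degree (p i))) (f i)" if i: "i \<in> I" for i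
    unfolding annihilates_def
  proof (intro allI impI)
    fix n assume n: "Suc (\<Sum>i\<in>I. degree (p i)) \<le> n"
    have "degree (p i) < n"
      using member_le_sum[of i I "\<lambda>i. degree (p i)"] assms(1) i n by simp
    then show "(\<Sum>j\<le>n. coeff q j * f i (n - j)) = 0"
      using fps_of_poly_mult_nth[of q "Abs_fps (f i)" n] p[OF i] by (simp add: coeff_eq_0)
  qed
  with q show ?thesis by blast
qed

lemma annihilates_imp_rational_fps:
  assumes "annihilates q N (fps_nth F)" "q \<noteq> 0"
  shows "rational_fps F"
proof -
  \<comment> \<open>The numerator is the part of \<open>fps_of_poly q * F\<close> below degree
    \<open>N\<close>; nothing remains above it.\<close>
  have "fps_of_poly q * F = fps_of_poly (\<Sum>i<N. monom ((fps_of_poly q * F) $ i) i)"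
    using assms(1)
    by (intro fps_ext)
      (auto simp: coeff_sum annihilates_def fps_of_poly_mult_nth simp del: fps_mult_nth)
  with assms(2) show ?thesis unfolding rational_fps_def by blast
qed

section \<open>Sums over words and the transfer recursion\<close>

lemma sum_lists_Suc:
  fixes f :: "'s list \<Rightarrow> 'r::comm_monoid_add"
  assumes "finite S"
  shows "(\<Sum>l | set l \<subseteq> S \<and> length l = Suc n. f l) =
    (\<Sum>s\<in>S. \<Sum>l | set l \<subseteq> S \<and> length l = n. f (s # l))"
proof -
  have "(\<Sum>s\<in>S. \<Sum>l | set l \<subseteq> S \<and> length l = n. f (s # l)) =
      (\<Sum>(s, l)\<in>S \<times> {l. set l \<subseteq> S \<and> length l = n}. f (s # l))"
    using assms by (simp add: sum.cartesian_product)
  also have "\<dots> = (\<Sum>l | set l \<subseteq> S \<and> length l = Suc n. f l)"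
    by (rule sum.reindex_bij_witness[of _ "\<lambda>l. (hd l, tl l)" "\<lambda>(s, l). s # l"])
      (auto simp: length_Suc_conv)
  finally show ?thesis ..
qed

text \<open>A state is a pair of consecutive layers, because the weight \<open>w s t u\<close> of
  the layer \<open>t\<close> involves both of its neighbours. The function \<open>g\<close> closes
  off the last pair.\<close>

fun transfer ::
    "'s set \<Rightarrow> ('s \<Rightarrow> 's \<Rightarrow> 's \<Rightarrow> 'r::idom) \<Rightarrow> nat \<Rightarrow> ('s \<Rightarrow> 's \<Rightarrow> 'r) \<Rightarrow> 's \<Rightarrow> 's \<Rightarrow> 'r" where
  "transfer S w 0 g s t = g s t"
| "transfer S w (Suc n) g s t = (\<Sum>u\<in>S. w s t u * transfer S w n g t u)"

lemma transfer_eq_sum_lists: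
  assumes "finite S"
  shows "transfer S w n g s t = (\<Sum>l | set l \<subseteq> S \<and> length l = n.
    (\<Prod>i<n. w ((s # t # l) ! i) ((s # t # l) ! Suc i) ((s # t # l) ! Suc (Suc i))) *
    g ((s # t # l) ! n) ((s # t # l) ! Suc n))"
proof (induction n arbitrary: s t)
  case 0
  have "{l. set l \<subseteq> S \<and> length l = 0} = {[]}" by auto
  then show ?case by simp
next
  case (Suc n)
  show ?case
    unfolding sum_lists_Suc[OF assms] transfer.simps Suc.IH
    by (simp add: sum_distrib_left prod.lessThan_Suc_shift mult.assoc del: prod.lessThan_Suc)
qed

text \<open>Splitting off the first step gives F(s,t) = g s t + x * (sum over u of w s t u *
  F(t,u)), a finite linear system whose matrix vanishes at x = 0.\<close>

lemma rational_fps_transfer: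
  assumes "finite S" "s \<in> S" "t \<in> S"
  shows "rational_fps (Abs_fps (\<lambda>n. transfer S w n g s t))"
proof -
  let ?F = "\<lambda>(s, t). Abs_fps (\<lambda>n. transfer S w n g s t)"
  let ?a = "\<lambda>(s, t) (t', u). if t' = t then [:0, w s t u:] else 0"
  have "rational_fps (?F (s, t))"
  proof (rule rational_fps_linear_system[of "S \<times> S" "\<lambda>_. 1" ?a ?F "\<lambda>(s, t). [:g s t:]"])
    fix p assume "p \<in> S \<times> S"
    then obtain s t where p: "p = (s, t)" "s \<in> S" "t \<in> S" by auto
    \<comment> \<open>Only pairs starting with \<open>t\<close> occur in the row of
      \<open>(s, t)\<close>, so the double sum collapses.\<close>
    have "(\<Sum>r\<in>S \<times> S. fps_of_poly (?a p r) * ?F r) =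
        (\<Sum>t'\<in>S. if t' = t then \<Sum>u\<in>S. fps_of_poly [:0, w s t u:] * ?F (t, u) else 0)"
      unfolding sum.cartesian_product' p by (rule sum.cong) auto
    also have "\<dots> = (\<Sum>u\<in>S. fps_of_poly [:0, w s t u:] * ?F (t, u))"
      using assms(1) p by simp
    finally have eq: "(\<Sum>r\<in>S \<times> S. fps_of_poly (?a p r) * ?F r) = \<dots>" .
    show "fps_of_poly 1 * ?F p = fps_of_poly (case p of (s, t) \<Rightarrow> [:g s t:]) +
        (\<Sum>r\<in>S \<times> S. fps_of_poly (?a p r) * ?F r)"
      unfolding eq
    proof (rule fps_ext)
      fix n
      show "(fps_of_poly 1 * ?F p) $ n = (fps_of_poly (case p of (s, t) \<Rightarrow> [:g s t:]) +
          (\<Sum>u\<in>S. fps_of_poly [:0, w s t u:] * ?F (t, u))) $ n"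
        by (cases n) (simp_all add: p fps_sum_nth fps_of_poly_pCons mult.assoc)
    qed
  qed (use assms in auto)
  then show ?thesis by simp
qed

text \<open>\<open>transfer\<close> is linear in \<open>g\<close>, and on
  \<open>S \<times> S\<close> the function \<open>g\<close> is a combination of indicators of single
  pairs.\<close>

lemma transfer_superposition:
  assumes "finite S" "s \<in> S" "t \<in> S"
  shows "transfer S w n g s t = (\<Sum>(x, y)\<in>S \<times> S.
    g x y * transfer S w n (\<lambda>x' y'. if x' = x \<and> y' = y then 1 else 0) s t)"
  using assms(2,3)
proof (induction n arbitrary: s t)
  case 0
  have "(\<Sum>(x, y)\<in>S \<times> S. g x y * (if s = x \<and> t = y then 1 else 0)) =
      (\<Sum>p\<in>S \<times> S. if (s, t) = p then g s t else 0)"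
    by (rule sum.cong) (auto split: if_splits)
  also have "\<dots> = g s t" using 0 assms(1) by simp
  finally show ?case by simp
next
  case (Suc n)
  let ?\<delta> = "\<lambda>x y x' y'. if x' = x \<and> y' = y then 1 else 0"
  have "transfer S w (Suc n) g s t =
      (\<Sum>u\<in>S. \<Sum>z\<in>S \<times> S. w s t u * (case z of (x, y) \<Rightarrow> g x y * transfer S w n (?\<delta> x y) t u))"
    unfolding transfer.simps sum_distrib_left[symmetric]
    by (rule sum.cong[OF refl], subst Suc.IH) (use Suc.prems in auto)
  also have "\<dots> = (\<Sum>(x, y)\<in>S \<times> S. g x y * transfer S w (Suc n) (?\<delta> x y) s t)"
    by (subst sum.swap) (simp add: case_prod_unfold sum_distrib_left mult.left_commute)
  finally show ?case .
qed

text \<open>The finitely many indicators have a common annihilator, and by superposition it serves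
  every \<open>g\<close>. Hence \<open>q\<close> and \<open>N\<close> are chosen before
  \<open>g\<close>.\<close>

lemma transfer_annihilator:
  assumes "finite S"
  shows "\<exists>q N. q \<noteq> 0 \<and>
    (\<forall>g. \<forall>s\<in>S. \<forall>t\<in>S. annihilates q N (\<lambda>n. transfer S w n g s t))"
proof -
  let ?\<delta> = "\<lambda>x y x' y'. if x' = x \<and> y' = y then 1 else 0"
  let ?f = "\<lambda>((x, y), (s, t)) n. transfer S w n (?\<delta> x y) s t"
  obtain q N where q: "q \<noteq> 0" "\<forall>i\<in>(S \<times> S) \<times> (S \<times> S). annihilates q N (?f i)"
    using rational_fps_common_annihilator[of "(S \<times> S) \<times> (S \<times> S)" ?f] assms
    by (fastforce simp: rational_fps_transfer)
  have "annihilates q N (\<lambda>n. transfer S w n g s t)" if "s \<in> S" "t \<in> S" for g s t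
  proof -
    have "annihilates q N (\<lambda>n. \<Sum>z\<in>S \<times> S. (case z of (x, y) \<Rightarrow> g x y) * ?f (z, (s, t)) n)"
      using q(2) that by (intro annihilates_sum annihilates_mult) blast
    then show ?thesis
      using that by (simp add: transfer_superposition[OF assms, of s t w _ g] case_prod_unfold)
  qed
  with q(1) show ?thesis by blast
qed

section \<open>Sums over compositions with zero parts allowed\<close>

lemma finite_compositions: "finite {ns :: nat list. length ns = m \<and> sum_list ns = n}"
  by (rule finite_subset[OF _ finite_lists_length_eq[of "{..n}" m]])
    (auto intro: member_le_sum_list)

lemma sum_compositions_Suc:
  fixes f :: "nat list \<Rightarrow> 'r::comm_monoid_add"
  shows "(\<Sum>ns | length ns = Suc m \<and> sum_list ns = n. f ns) =
    (\<Sum>i\<le>n. \<Sum>ns | length ns = m \<and> sum_list ns = n - i. f (i # ns))"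
proof -
  have "(\<Sum>i\<le>n. \<Sum>ns | length ns = m \<and> sum_list ns = n - i. f (i # ns)) =
      (\<Sum>(i, ns)\<in>(SIGMA i:{..n}. {ns. length ns = m \<and> sum_list ns = n - i}). f (i # ns))"
    by (rule sum.Sigma) (auto simp: finite_compositions)
  also have "\<dots> = (\<Sum>ns | length ns = Suc m \<and> sum_list ns = n. f ns)"
    by (rule sum.reindex_bij_witness[of _ "\<lambda>ns. (hd ns, tl ns)" "\<lambda>(i, ns). i # ns"])
      (auto simp: length_Suc_conv)
  finally show ?thesis ..
qed

text \<open>This is \<open>\<Sum>i. G i * x ^ i\<close>.\<close>

definition stack :: "(nat \<Rightarrow> 'r::idom fps) \<Rightarrow> 'r fps" where
  "stack G = Abs_fps (\<lambda>n. \<Sum>i\<le>n. G i $ (n - i))"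

text \<open>A power \<open>x ^ j\<close> in \<open>q\<close> is absorbed into the index, so
  multiplication by \<open>q\<close> becomes a recurrence along \<open>i\<close> with constant
  coefficients.\<close>

lemma fps_of_poly_mult_stack:
  "fps_of_poly q * stack G = stack (\<lambda>i. \<Sum>j\<le>i. fps_const (coeff q j) * G (i - j))"
proof (rule fps_ext)
  fix n
  have "(fps_of_poly q * stack G) $ n =
      (\<Sum>(j, i)\<in>(SIGMA j:{..n}. {..n - j}). coeff q j * G i $ (n - j - i))"
    by (simp add: fps_of_poly_mult_nth stack_def sum_distrib_left sum.Sigma)
  also have "\<dots> = (\<Sum>(i, j)\<in>(SIGMA i:{..n}. {..i}). coeff q j * G (i - j) $ (n - i))"
    by (rule sum.reindex_bij_witness[of _ "\<lambda>(i, j). (j, i - j)" "\<lambda>(j, i). (i + j, j)"])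
      (auto simp: add.commute)
  also have "\<dots> = stack (\<lambda>i. \<Sum>j\<le>i. fps_const (coeff q j) * G (i - j)) $ n"
    by (simp add: stack_def fps_sum_nth sum.Sigma)
  finally show "(fps_of_poly q * stack G) $ n =
      stack (\<lambda>i. \<Sum>j\<le>i. fps_const (coeff q j) * G (i - j)) $ n" .
qed

lemma rational_fps_stack:
  assumes "\<And>i. rational_fps (G i)" "\<And>i. N \<le> i \<Longrightarrow> G i = 0"
  shows "rational_fps (stack G)"
proof -
  have "stack G = (\<Sum>i<N. fps_of_poly (monom 1 i) * G i)"
  proof (rule fps_ext)
    fix n
    have "stack G $ n = (\<Sum>i\<le>n. G i $ (n - i))" by (simp add: stack_def)
    also have "\<dots> = (\<Sum>i\<in>{..n} \<inter> {..<N}. G i $ (n - i))"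
      using assms(2) by (intro sum.mono_neutral_right) (auto simp: not_less)
    also have "\<dots> = (\<Sum>i<N. if i \<le> n then G i $ (n - i) else 0)"
      by (subst Int_commute, subst sum.inter_restrict) simp_all
    also have "\<dots> = (\<Sum>i<N. fps_of_poly (monom 1 i) * G i) $ n"
      by (auto simp: fps_sum_nth fps_of_poly_monom fps_X_power_mult_nth intro!: sum.cong)
    finally show "stack G $ n = (\<Sum>i<N. fps_of_poly (monom 1 i) * G i) $ n" .
  qed
  then show ?thesis
    by (simp add: rational_fps_sum rational_fps_poly_mult assms)
qed

text \<open>Grouping by the first entry gives a \<open>stack\<close> of series that are rational by
  induction. The recurrence in the first entry holds with the other entries fixed, so multiplication
  by \<open>q\<close> leaves only the indices below \<open>N\<close>. This uses that
  \<open>q\<close> and \<open>N\<close> do not depend on the fixed entries.\<close>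

lemma rational_fps_compositions:
  assumes "q \<noteq> 0"
    and "\<And>k ns. k < m \<Longrightarrow> length ns = m \<Longrightarrow> annihilates q N (\<lambda>n. f (ns[k := n]))"
  shows "rational_fps (Abs_fps (\<lambda>n. \<Sum>ns | length ns = m \<and> sum_list ns = n. f ns))"
  using assms(2)
proof (induction m arbitrary: f)
  case 0
  have "{ns :: nat list. length ns = 0 \<and> sum_list ns = n} = (if n = 0 then {[]} else {})" for n
    by auto
  then have "Abs_fps (\<lambda>n. \<Sum>ns | length ns = 0 \<and> sum_list ns = n. f ns) = fps_of_poly [:f []:]"
    by (intro fps_ext) (simp add: fps_of_poly_const)
  then show ?case by (simp only: rational_fps_of_poly)
next
  case (Suc m)
  define G where "G i = Abs_fps (\<lambda>n. \<Sum>ns | length ns = m \<and> sum_list ns = n. f (i # ns))" for i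
  \<comment> \<open>These are the entries of the stack
    \<open>fps_of_poly q * stack G\<close>.\<close>
  define E where "E i = (\<Sum>j\<le>i. fps_const (coeff q j) * G (i - j))" for i
  have G: "rational_fps (G i)" for i
    unfolding G_def
  proof (rule Suc.IH)
    fix k and ns :: "nat list" assume "k < m" "length ns = m"
    then show "annihilates q N (\<lambda>n. f (i # ns[k := n]))"
      using Suc.prems[of "Suc k" "i # ns"] by simp
  qed
  have E: "rational_fps (E i)" for i
    unfolding E_def fps_of_poly_const[symmetric]
    by (intro rational_fps_sum rational_fps_poly_mult G)
  have "E i = 0" if i: "N \<le> i" for i
  proof (rule fps_ext)
    fix n
    have "E i $ n = (\<Sum>ns | length ns = m \<and> sum_list ns = n.
        \<Sum>j\<le>i. coeff q j * f ((i - j) # ns))"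
      by (subst sum.swap) (simp add: E_def G_def fps_sum_nth sum_distrib_left)
    also have "\<dots> = 0"
    proof (rule sum.neutral, safe)
      fix ns :: "nat list" assume "m = length ns"
      then show "(\<Sum>j\<le>i. coeff q j * f ((i - j) # ns)) = 0"
        \<comment> \<open>The head \<open>0\<close> is a placeholder that the update at position
          \<open>0\<close> overwrites.\<close>
        using Suc.prems[of 0 "0 # ns"] i by (simp add: annihilates_def)
    qed
    finally show "E i $ n = 0 $ n" by simp
  qed
  with E have "rational_fps (fps_of_poly q * stack G)"
    unfolding fps_of_poly_mult_stack E_def[symmetric] by (rule rational_fps_stack)
  then have "rational_fps (stack G)"
    using assms(1) by (rule rational_fps_cancel)
  then show ?case
    by (simp add: stack_def G_def sum_compositions_Suc)
qed

section \<open>Weights of black sets\<close>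

definition parity_weight :: "bool \<Rightarrow> nat \<Rightarrow> bw_poly" where
  "parity_weight blk m = (if blk then var_b else if even m then var_w_plus else var_w_minus)"

definition black_weight :: "'v pair_pre_digraph \<Rightarrow> 'v set \<Rightarrow> bw_poly" where
  "black_weight K B =
     (\<Prod>v\<in>pverts K. parity_weight (v \<in> B) (card {u \<in> B. (v, u) \<in> parcs K}))"

text \<open>A coloring amounts to its black set, and collecting equal factors gives the monomial.
  The product over vertices is the form that splits along a core and layers.\<close>

lemma full_W_eq_sum_black_weight:
  assumes "finite (pverts K)"
  shows "full_W K = (\<Sum>B\<in>Pow (pverts K). black_weight K B)"
  unfolding full_W_def
proof (rule sum.reindex_bij_witness[of _ "\<lambda>B. \<lambda>v\<in>pverts K. if v \<in> B then 1 else 0" "black K"])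
  fix c assume c: "c \<in> colorings K"
  then have c01: "c v = 0 \<or> c v = 1" if "v \<in> pverts K" for v
    using that by (auto simp: colorings_def PiE_iff)
  show "(\<lambda>v\<in>pverts K. if v \<in> black K c then 1 else 0) = c"
    using c c01 by (intro ext) (auto simp: colorings_def black_def PiE_iff extensional_def)
  let ?V = "pverts K" and ?P = "\<lambda>v. even (card {u \<in> black K c. (v, u) \<in> parcs K})"
  have sets: "?V \<inter> {v. v \<in> black K c} = black K c"
    "?V \<inter> - {v. v \<in> black K c} \<inter> {v. ?P v} = white_even K c"
    "?V \<inter> - {v. v \<in> black K c} \<inter> - {v. ?P v} = white_odd K c"
    using c01 by (auto simp: black_def white_even_def white_odd_def black_nbs_def)
  show "black_weight K (black K c) = var_b ^ card (black K c) *
      var_w_plus ^ card (white_even K c) * var_w_minus ^ card (white_odd K c)"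
    using assms
    by (simp only: black_weight_def parity_weight_def prod.If_cases finite_Int sets prod_constant
        mult.assoc simp_thms)
qed (auto simp: colorings_def black_def)

text \<open>Adjacency is compared on vertices only, because \<open>chain\<close> below also relates
  pairs outside its vertex set.\<close>

lemma full_W_iso:
  assumes "inj_on \<phi> (pverts K)" "pverts K' = \<phi> ` pverts K" "finite (pverts K)"
    and "\<And>u v. u \<in> pverts K \<Longrightarrow> v \<in> pverts K \<Longrightarrow>
      (\<phi> u, \<phi> v) \<in> parcs K' \<longleftrightarrow> (u, v) \<in> parcs K"
  shows "full_W K' = full_W K"
proof -
  have weight: "black_weight K' (\<phi> ` B) = black_weight K B" if B: "B \<subseteq> pverts K" for B
    unfolding black_weight_def assms(2) prod.reindex[OF assms(1)] o_def
  proof (rule prod.cong[OF refl])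
    fix v assume v: "v \<in> pverts K"
    have "{u \<in> \<phi> ` B. (\<phi> v, u) \<in> parcs K'} = \<phi> ` {u \<in> B. (v, u) \<in> parcs K}"
      using assms(4) B v by auto
    moreover have "card (\<phi> ` {u \<in> B. (v, u) \<in> parcs K}) = card {u \<in> B. (v, u) \<in> parcs K}"
      using B by (intro card_image inj_on_subset[OF assms(1)]) auto
    moreover have "\<phi> v \<in> \<phi> ` B \<longleftrightarrow> v \<in> B"
      using assms(1) B v by (simp add: inj_on_image_mem_iff)
    ultimately show "parity_weight (\<phi> v \<in> \<phi> ` B) (card {u \<in> \<phi> ` B. (\<phi> v, u) \<in> parcs K'}) =
        parity_weight (v \<in> B) (card {u \<in> B. (v, u) \<in> parcs K})"
      by simp
  qed
  have "full_W K' = (\<Sum>B\<in>(`) \<phi> ` Pow (pverts K). black_weight K' B)"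
    using assms(2,3) by (simp add: full_W_eq_sum_black_weight image_Pow_surj)
  also have "\<dots> = (\<Sum>B\<in>Pow (pverts K). black_weight K B)"
    by (subst sum.reindex[OF inj_on_image_Pow[OF assms(1)]]) (simp add: weight)
  finally show ?thesis
    by (simp add: full_W_eq_sum_black_weight assms(3))
qed

section \<open>Chains attached to a core\<close>

text \<open>\<open>R\<close> and \<open>R'\<close> are arbitrary so that one construction covers
  paths (\<open>R'\<close> empty), cycles (both ends attached alike) and subdivided edges (one core
  vertex at each end).\<close>

fun chain_adj :: "'v pair_pre_digraph \<Rightarrow> 'u pair_pre_digraph \<Rightarrow> ('v \<times> 'u) set \<Rightarrow> ('v \<times> 'u) set \<Rightarrow>
    nat \<Rightarrow> 'v + 'u \<times> nat \<Rightarrow> 'v + 'u \<times> nat \<Rightarrow> bool" where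
  "chain_adj K H R R' n (Inl x) (Inl y) \<longleftrightarrow> (x, y) \<in> parcs K"
| "chain_adj K H R R' n (Inl x) (Inr (u, i)) \<longleftrightarrow> i = 0 \<and> (x, u) \<in> R \<or> Suc i = n \<and> (x, u) \<in> R'"
| "chain_adj K H R R' n (Inr (u, i)) (Inl x) \<longleftrightarrow> i = 0 \<and> (x, u) \<in> R \<or> Suc i = n \<and> (x, u) \<in> R'"
| "chain_adj K H R R' n (Inr (u, i)) (Inr (v, j)) \<longleftrightarrow>
     i = j \<and> (u, v) \<in> parcs H \<or> u = v \<and> (j = Suc i \<or> i = Suc j)"

text \<open>
  The core \<open>K\<close> with the layers \<open>0, \<dots>, n - 1\<close> of \<open>H \<times> P\<^sub>n\<close> attached to it: layer \<open>0\<close> by the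
  edges in \<open>R\<close> and layer \<open>n - 1\<close> by the edges in \<open>R'\<close>.
\<close>

definition chain :: "'v pair_pre_digraph \<Rightarrow> 'u pair_pre_digraph \<Rightarrow> ('v \<times> 'u) set \<Rightarrow> ('v \<times> 'u) set \<Rightarrow>
    nat \<Rightarrow> ('v + 'u \<times> nat) pair_pre_digraph" where
  "chain K H R R' n = \<lparr> pverts = pverts K <+> pverts H \<times> {..<n},
     parcs = {(x, y). chain_adj K H R R' n x y} \<rparr>"

definition join :: "'v set \<Rightarrow> 'u set list \<Rightarrow> ('v + 'u \<times> nat) set" where
  "join B L = B <+> {(u, i). i < length L \<and> u \<in> L ! i}"

lemma mem_join [simp]:
  "Inl x \<in> join B L \<longleftrightarrow> x \<in> B"
  "Inr (u, i) \<in> join B L \<longleftrightarrow> i < length L \<and> u \<in> L ! i"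
  by (auto simp: join_def)

lemma sum_Pow_chain:
  assumes "finite (pverts K)" "finite (pverts H)"
  shows "(\<Sum>B\<in>Pow (pverts (chain K H R R' n)). f B) =
    (\<Sum>B\<in>Pow (pverts K). \<Sum>L | set L \<subseteq> Pow (pverts H) \<and> length L = n. f (join B L))"
proof -
  have "(\<Sum>B\<in>Pow (pverts K). \<Sum>L | set L \<subseteq> Pow (pverts H) \<and> length L = n. f (join B L)) =
      (\<Sum>(B, L)\<in>Pow (pverts K) \<times> {L. set L \<subseteq> Pow (pverts H) \<and> length L = n}. f (join B L))"
    by (simp add: sum.cartesian_product)
  also have "\<dots> = (\<Sum>B\<in>Pow (pverts (chain K H R R' n)). f B)"
  proof (rule sum.reindex_bij_witness[of _
        "\<lambda>B. (Inl -` B, map (\<lambda>i. {u. Inr (u, i) \<in> B}) [0..<n])" "\<lambda>(B, L). join B L"],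
      goal_cases)
    case (1 z)
    then show ?case by (auto simp: join_def intro!: nth_equalityI)
  next
    case (2 z)
    then show ?case by (fastforce simp: join_def chain_def dest: nth_mem)
  next
    case (3 B)
    then show ?case by (fastforce simp: join_def chain_def Plus_def)
  next
    case (4 B)
    then show ?case by (fastforce simp: join_def chain_def Plus_def)
  next
    case (5 z)
    then show ?case by auto
  qed
  finally show ?thesis ..
qed

text \<open>The bound \<open>2 \<le> n\<close> separates the two end layers; in a single layer, a
  vertex adjacent through both relations would be counted twice.\<close>

lemma card_black_nbs_core:
  assumes "finite B" "\<And>s. s \<in> set L \<Longrightarrow> finite s" "length L = n" "2 \<le> n"
  shows "card {y \<in> join B L. (Inl x, y) \<in> parcs (chain K H R R' n)} =
    card {y \<in> B. (x, y) \<in> parcs K} + card {u \<in> L ! 0. (x, u) \<in> R} +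
    card {u \<in> L ! (n - 1). (x, u) \<in> R'}"
proof -
  let ?A = "Inl ` {y \<in> B. (x, y) \<in> parcs K} :: ('a + 'b \<times> nat) set"
  let ?S = "\<lambda>i R. (\<lambda>u. Inr (u, i)) ` {u \<in> L ! i. (x, u) \<in> R} :: ('a + 'b \<times> nat) set"
  have "{y \<in> join B L. (Inl x, y) \<in> parcs (chain K H R R' n)} = ?A \<union> ?S 0 R \<union> ?S (n - 1) R'"
  proof -
    obtain m where "n = Suc m" using assms(4) by (cases n) auto
    then show ?thesis
      using assms(3) by (auto simp: join_def chain_def image_iff)
  qed
  moreover have "card (?A \<union> ?S 0 R \<union> ?S (n - 1) R') = card ?A + card (?S 0 R) + card (?S (n - 1) R')"
  proof -
    have fin: "finite ?A" "finite (?S 0 R)" "finite (?S (n - 1) R')" using assms by auto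
    have "?A \<inter> ?S 0 R = {}" "(?A \<union> ?S 0 R) \<inter> ?S (n - 1) R' = {}"
      using assms(4) by auto
    then show ?thesis by (simp only: card_Un_disjoint finite_Un fin simp_thms)
  qed
  ultimately show ?thesis
    by (simp add: card_image inj_on_def)
qed

text \<open>The guard \<open>0 < i\<close> matters: at \<open>i = 0\<close> truncated subtraction
  makes \<open>i - 1\<close> the layer itself.\<close>

lemma card_black_nbs_layer:
  assumes "finite B" "\<And>s. s \<in> set L \<Longrightarrow> finite s" "length L = n" "i < n" "2 \<le> n"
  shows "card {y \<in> join B L. (Inr (u, i), y) \<in> parcs (chain K H R R' n)} =
    card {v \<in> L ! i. (u, v) \<in> parcs H} +
    of_bool (0 < i \<and> u \<in> L ! (i - 1)) + of_bool (Suc i < n \<and> u \<in> L ! Suc i) +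
    card {x \<in> B. i = 0 \<and> (x, u) \<in> R \<or> Suc i = n \<and> (x, u) \<in> R'}"
proof -
  let ?A = "Inl ` {x \<in> B. i = 0 \<and> (x, u) \<in> R \<or> Suc i = n \<and> (x, u) \<in> R'} :: ('a + 'b \<times> nat) set"
  let ?S = "(\<lambda>v. Inr (v, i)) ` {v \<in> L ! i. (u, v) \<in> parcs H} :: ('a + 'b \<times> nat) set"
  let ?P = "if 0 < i \<and> u \<in> L ! (i - 1) then {Inr (u, i - 1)} else {} :: ('a + 'b \<times> nat) set"
  let ?Q = "if Suc i < n \<and> u \<in> L ! Suc i then {Inr (u, Suc i)} else {} :: ('a + 'b \<times> nat) set"
  have "{y \<in> join B L. (Inr (u, i), y) \<in> parcs (chain K H R R' n)} = ?S \<union> ?P \<union> ?Q \<union> ?A"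
    using assms(3-5) by (auto simp: join_def chain_def image_iff)
  moreover have "card (?S \<union> ?P \<union> ?Q \<union> ?A) = card ?S + card ?P + card ?Q + card ?A"
  proof -
    have fin: "finite ?S" "finite ?P" "finite ?Q" "finite ?A" using assms by auto
    have "?S \<inter> ?P = {}" "(?S \<union> ?P) \<inter> ?Q = {}" "(?S \<union> ?P \<union> ?Q) \<inter> ?A = {}"
      by (auto split: if_splits)
    then show ?thesis by (simp only: card_Un_disjoint finite_Un fin simp_thms)
  qed
  ultimately show ?thesis
    by (simp add: card_image inj_on_def)
qed

text \<open>\<open>s\<close> and \<open>r\<close> are the neighbouring layers, empty where there is
  none; \<open>e\<close> counts black neighbours in the core and is zero for inner layers.\<close>

definition layer_weight ::
    "'u pair_pre_digraph \<Rightarrow> ('u \<Rightarrow> nat) \<Rightarrow> 'u set \<Rightarrow> 'u set \<Rightarrow> 'u set \<Rightarrow> bw_poly" where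
  "layer_weight H e s t r = (\<Prod>u\<in>pverts H. parity_weight (u \<in> t)
     (card {v \<in> t. (u, v) \<in> parcs H} + of_bool (u \<in> s) + of_bool (u \<in> r) + e u))"

definition core_weight :: "'v pair_pre_digraph \<Rightarrow> ('v \<times> 'u) set \<Rightarrow> ('v \<times> 'u) set \<Rightarrow>
    'v set \<Rightarrow> 'u set \<Rightarrow> 'u set \<Rightarrow> bw_poly" where
  "core_weight K R R' B s t = (\<Prod>x\<in>pverts K. parity_weight (x \<in> B)
     (card {y \<in> B. (x, y) \<in> parcs K} + card {u \<in> s. (x, u) \<in> R} + card {u \<in> t. (x, u) \<in> R'}))"

text \<open>These are the factors that see the core. For fixed \<open>B\<close>, \<open>s\<close>,
  \<open>s'\<close> they form a function of the last two layers, as \<open>transfer\<close> expects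
  for \<open>g\<close>.\<close>

definition end_weight :: "'v pair_pre_digraph \<Rightarrow> 'u pair_pre_digraph \<Rightarrow> ('v \<times> 'u) set \<Rightarrow>
    ('v \<times> 'u) set \<Rightarrow> 'v set \<Rightarrow> 'u set \<Rightarrow> 'u set \<Rightarrow> 'u set \<Rightarrow> 'u set \<Rightarrow> bw_poly" where
  "end_weight K H R R' B s s' t t' = core_weight K R R' B s t' *
     layer_weight H (\<lambda>u. card {x \<in> B. (x, u) \<in> R}) {} s s' *
     layer_weight H (\<lambda>u. card {x \<in> B. (x, u) \<in> R'}) t t' {}"

lemma black_weight_chain:
  assumes "finite (pverts K)" "finite (pverts H)" "B \<subseteq> pverts K"
    and "set L \<subseteq> Pow (pverts H)" "length L = n + 2"
  shows "black_weight (chain K H R R' (n + 2)) (join B L) =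
    (\<Prod>i<n. layer_weight H (\<lambda>_. 0) (L ! i) (L ! Suc i) (L ! Suc (Suc i))) *
    end_weight K H R R' B (L ! 0) (L ! 1) (L ! n) (L ! Suc n)"
proof -
  let ?C = "chain K H R R' (n + 2)" and ?J = "join B L"
  let ?w = "\<lambda>y. parity_weight (y \<in> ?J) (card {z \<in> ?J. (y, z) \<in> parcs ?C})"
  have fin: "finite B" "\<And>s. s \<in> set L \<Longrightarrow> finite s"
    using assms by (auto intro: finite_subset)
  have core: "(\<Prod>x\<in>pverts K. ?w (Inl x)) = core_weight K R R' B (L ! 0) (L ! Suc n)"
    unfolding core_weight_def
    using card_black_nbs_core[OF fin assms(5)] assms(5)
    by (intro prod.cong) auto
  \<comment> \<open>Stated uniformly in \<open>i\<close>, so that the first and last factors can be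
    split off once the product over all layers is formed.\<close>
  have layer: "(\<Prod>u\<in>pverts H. ?w (Inr (u, i))) = layer_weight H
      (\<lambda>u. card {x \<in> B. i = 0 \<and> (x, u) \<in> R \<or> i = Suc n \<and> (x, u) \<in> R'})
      (if i = 0 then {} else L ! (i - 1)) (L ! i) (if i = Suc n then {} else L ! Suc i)"
    if "i < n + 2" for i
    unfolding layer_weight_def
    using card_black_nbs_layer[OF fin assms(5) that] that assms(5)
    by (intro prod.cong arg_cong2[of _ _ _ _ parity_weight]) auto
  have "black_weight ?C ?J = (\<Prod>y\<in>pverts K <+> pverts H \<times> {..<n + 2}. ?w y)"
    by (simp add: black_weight_def chain_def)
  also have "\<dots> = (\<Prod>x\<in>pverts K. ?w (Inl x)) * (\<Prod>p\<in>pverts H \<times> {..<n + 2}. ?w (Inr p))"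
    using assms(1,2) by (subst prod.Plus) (simp_all add: o_def)
  also have "(\<Prod>p\<in>pverts H \<times> {..<n + 2}. ?w (Inr p)) = (\<Prod>i<n + 2. \<Prod>u\<in>pverts H. ?w (Inr (u, i)))"
    unfolding prod.cartesian_product' by (rule prod.swap)
  also have "\<dots> = (\<Prod>i<Suc (Suc n). layer_weight H
      (\<lambda>u. card {x \<in> B. i = 0 \<and> (x, u) \<in> R \<or> i = Suc n \<and> (x, u) \<in> R'})
      (if i = 0 then {} else L ! (i - 1)) (L ! i) (if i = Suc n then {} else L ! Suc i))"
    by (intro prod.cong layer) auto
  also have "\<dots> = layer_weight H (\<lambda>u. card {x \<in> B. (x, u) \<in> R}) {} (L ! 0) (L ! 1) *
      (\<Prod>i<n. layer_weight H (\<lambda>_. 0) (L ! i) (L ! Suc i) (L ! Suc (Suc i))) *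
      layer_weight H (\<lambda>u. card {x \<in> B. (x, u) \<in> R'}) (L ! n) (L ! Suc n) {}"
    by (subst prod.lessThan_Suc, subst prod.lessThan_Suc_shift) simp
  finally show ?thesis
    unfolding core end_weight_def by (simp add: mult_ac)
qed

text \<open>With the core part and the first two layers fixed, the sum over the remaining
  \<open>n\<close> layers is a value of \<open>transfer\<close>.\<close>

lemma full_W_chain:
  assumes "finite (pverts K)" "finite (pverts H)"
  shows "full_W (chain K H R R' (n + 2)) = (\<Sum>B\<in>Pow (pverts K). \<Sum>s\<in>Pow (pverts H).
    \<Sum>t\<in>Pow (pverts H).
      transfer (Pow (pverts H)) (layer_weight H (\<lambda>_. 0)) n (end_weight K H R R' B s t) s t)"
proof -
  have fin: "finite (Pow (pverts H))" using assms by simp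
  have "full_W (chain K H R R' (n + 2)) =
      (\<Sum>B\<in>Pow (pverts (chain K H R R' (n + 2))). black_weight (chain K H R R' (n + 2)) B)"
    using assms by (intro full_W_eq_sum_black_weight) (simp add: chain_def)
  also have "\<dots> = (\<Sum>B\<in>Pow (pverts K). \<Sum>L | set L \<subseteq> Pow (pverts H) \<and> length L = Suc (Suc n).
      (\<Prod>i<n. layer_weight H (\<lambda>_. 0) (L ! i) (L ! Suc i) (L ! Suc (Suc i))) *
      end_weight K H R R' B (L ! 0) (L ! 1) (L ! n) (L ! Suc n))"
    unfolding sum_Pow_chain[OF assms]
    using black_weight_chain[OF assms] by (intro sum.cong) auto
  finally show ?thesis
    unfolding sum_lists_Suc[OF fin] transfer_eq_sum_lists[OF fin] by simp
qed

text \<open>The core and the attaching edges enter only through the final function, for which the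
  annihilator is uniform.\<close>

lemma chain_annihilator:
  fixes H :: "'u pair_pre_digraph"
  assumes "finite (pverts H)"
  shows "\<exists>q N. q \<noteq> 0 \<and> (\<forall>(K :: 'v pair_pre_digraph) R R'. finite (pverts K) \<longrightarrow>
    annihilates q N (\<lambda>n. full_W (chain K H R R' (n + 2))))"
proof -
  obtain q N where q: "q \<noteq> 0" and ann: "\<forall>g. \<forall>s\<in>Pow (pverts H). \<forall>t\<in>Pow (pverts H).
      annihilates q N (\<lambda>n. transfer (Pow (pverts H)) (layer_weight H (\<lambda>_. 0)) n g s t)"
    using transfer_annihilator[of "Pow (pverts H)"] assms by blast
  have "annihilates q N (\<lambda>n. full_W (chain K H R R' (n + 2)))"
    if "finite (pverts K)" for K :: "'v pair_pre_digraph" and R R'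
    unfolding full_W_chain[OF that assms]
    using ann by (intro annihilates_sum) blast
  with q show ?thesis by blast
qed

section \<open>Products with paths and cycles\<close>

text \<open>The common form of \<open>graph_X\<close> and \<open>graph_E\<close>, with the path or
  cycle as a parameter.\<close>

definition attach ::
    "'a pair_pre_digraph \<Rightarrow> 'a pair_pre_digraph \<Rightarrow> nat pair_pre_digraph \<Rightarrow> ('a \<times> nat) pair_pre_digraph" where
  "attach G H P = identify (case_sum (\<lambda>v. (v, 1)) (\<lambda>p. p)) (disjoint_sum G (box_product H P))"

lemma pverts_attach: "pverts (attach G H P) = (\<lambda>v. (v, 1)) ` pverts G \<union> pverts H \<times> pverts P"
  by (simp add: attach_def identify_def disjoint_sum_def box_product_def image_Un image_image)

lemma parcs_attach:
  "((u, i), (v, j)) \<in> parcs (attach G H P) \<longleftrightarrow>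
    i = 1 \<and> j = 1 \<and> (u, v) \<in> parcs G \<or> ((u, i), (v, j)) \<in> parcs (box_product H P)"
  by (auto simp: attach_def identify_def disjoint_sum_def image_Un image_image map_prod_def
      case_prod_unfold image_iff) force+

lemma subgraph_with_projD:
  assumes "subgraph (with_proj H) (with_proj G)"
  shows "pverts H \<subseteq> pverts G" "parcs H \<subseteq> parcs G"
  using assms by (auto simp: subgraph_def)

text \<open>The copy of \<open>G\<close> glued into layer \<open>1\<close> already lies in the
  product. This makes products the case \<open>H = G\<close> of attached chains.\<close>

lemma box_product_eq_attach:
  assumes "pair_graph G" "1 \<in> pverts P"
  shows "box_product G P = attach G G P"
proof -
  interpret pair_graph G by fact
  show ?thesis
  proof (rule pair_pre_digraph.equality)
    show "pverts (box_product G P) = pverts (attach G G P)"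
      using assms(2) by (auto simp: pverts_attach box_product_def)
    show "parcs (box_product G P) = parcs (attach G G P)"
      using assms(2) in_arcsD1 in_arcsD2 by (auto simp: set_eq_iff parcs_attach) (auto simp: box_product_def)
  qed simp
qed

text \<open>Layer \<open>1\<close>, which carries \<open>G\<close>, is the core, and layers
  \<open>2\<close> to \<open>n + 3\<close> form the chain. Layer \<open>2\<close> is attached along
  the identity of \<open>H\<close>, and in the cyclic case so is the last layer.\<close>

lemma full_W_attach_chain:
  assumes "pair_graph G" "pair_graph H" "subgraph (with_proj H) (with_proj G)"
    and verts: "pverts P = {1..n + 3}"
    and arcs: "\<And>i j. i \<in> {1..n + 3} \<Longrightarrow> j \<in> {1..n + 3} \<Longrightarrow> (i, j) \<in> parcs P \<longleftrightarrow>
      j = i + 1 \<or> i = j + 1 \<or> cyclic \<and> (i = 1 \<and> j = n + 3 \<or> i = n + 3 \<and> j = 1)"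
  shows "full_W (attach G H P) =
    full_W (chain G H (Id_on (pverts H)) (if cyclic then Id_on (pverts H) else {}) (n + 2))"
proof -
  interpret G: pair_graph G by fact
  interpret H: pair_graph H by fact
  note HG = subgraph_with_projD[OF assms(3)]
  let ?C = "chain G H (Id_on (pverts H)) (if cyclic then Id_on (pverts H) else {}) (n + 2)"
  \<comment> \<open>The shift is \<open>2\<close> because chain layers count from \<open>0\<close>
    and layer \<open>1\<close> of the product is the core.\<close>
  let ?\<phi> = "case_sum (\<lambda>v. (v, 1)) (\<lambda>(h, i). (h, i + 2))"
  show ?thesis
  proof (rule full_W_iso[of ?\<phi>])
    show "inj_on ?\<phi> (pverts ?C)"
      by (auto simp: chain_def inj_on_def)
    have "{1..n + 3} = insert 1 ((\<lambda>i. i + 2) ` {..<n + 2})"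
      by (auto simp: image_iff Ball_def) presburger
    then show "pverts (attach G H P) = ?\<phi> ` pverts ?C"
      using HG(1) by (auto simp: pverts_attach verts chain_def Plus_def image_Un image_image
          case_prod_unfold image_iff)
    show "finite (pverts ?C)"
      by (simp add: chain_def)
    fix x y assume xy: "x \<in> pverts ?C" "y \<in> pverts ?C"
    show "(?\<phi> x, ?\<phi> y) \<in> parcs (attach G H P) \<longleftrightarrow> (x, y) \<in> parcs ?C"
    proof (cases x; cases y)
      fix u v assume "x = Inl u" "y = Inl v"
      then show ?thesis
        using xy HG arcs[of 1 1] by (auto simp: parcs_attach box_product_def chain_def)
    next
      fix u q assume "x = Inl u" "y = Inr q"
      then show ?thesis
        using xy HG arcs[of 1 "snd q + 2"]
        by (cases q) (auto simp: parcs_attach box_product_def chain_def verts)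
    next
      fix u q assume "x = Inr q" "y = Inl u"
      then show ?thesis
        using xy HG arcs[of "snd q + 2" 1]
        by (cases q) (auto simp: parcs_attach box_product_def chain_def verts)
    next
      fix p q assume "x = Inr p" "y = Inr q"
      then show ?thesis
        using xy HG arcs[of "snd p + 2" "snd q + 2"] H.in_arcsD1 H.in_arcsD2
        by (cases p; cases q) (auto simp: parcs_attach box_product_def chain_def verts)
    qed
  qed
qed

lemma cycle_graph_arcs:
  assumes "i \<in> {1..n}" "j \<in> {1..n}"
  shows "(i, j) \<in> parcs (cycle_graph n) \<longleftrightarrow>
    j = i + 1 \<or> i = j + 1 \<or> i = 1 \<and> j = n \<or> i = n \<and> j = 1"
proof -
  have "m mod n = (if m = n then 0 else m)" if "m \<in> {1..n}" for m
    using that by auto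
  then show ?thesis using assms by (auto simp: cycle_graph_def)
qed

text \<open>Three vertices of the path or cycle leave the two layers that
  \<open>full_W_chain\<close> starts from. Terms of lower index are absorbed by
  \<open>annihilates_shift\<close>.\<close>

lemma rational_fps_attach:
  assumes "pair_graph G" "pair_graph H" "subgraph (with_proj H) (with_proj G)"
    and "\<And>n. pverts (P (n + 3)) = {1..n + 3}"
    and "\<And>n i j. i \<in> {1..n + 3} \<Longrightarrow> j \<in> {1..n + 3} \<Longrightarrow> (i, j) \<in> parcs (P (n + 3)) \<longleftrightarrow>
      j = i + 1 \<or> i = j + 1 \<or> cyclic \<and> (i = 1 \<and> j = n + 3 \<or> i = n + 3 \<and> j = 1)"
    and "\<And>n. \<G> (n + 3) = {#attach G H (P (n + 3))#}"
  shows "rational_fps (full_Xi \<G>)"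
proof -
  have fin: "finite (pverts G)" "finite (pverts H)"
    using assms(1,2) by (simp_all add: pair_fin_digraph.pair_finite_verts pair_digraph_def pair_graph_def)
  obtain q N where q: "q \<noteq> 0" and ann: "\<And>K R R'. finite (pverts (K :: 'a pair_pre_digraph)) \<Longrightarrow>
      annihilates q N (\<lambda>n. full_W (chain K H R R' (n + 2)))"
    using chain_annihilator[OF fin(2)] by blast
  have "full_Xi \<G> $ (n + 3) =
      full_W (chain G H (Id_on (pverts H)) (if cyclic then Id_on (pverts H) else {}) (n + 2))" for n
    using full_W_attach_chain[OF assms(1-3) assms(4) assms(5), of n]
    by (simp add: full_Xi_def assms(6))
  then have "annihilates q N (\<lambda>n. full_Xi \<G> $ (n + 3))"
    using ann[OF fin(1)] by simp
  then show ?thesis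
    using annihilates_imp_rational_fps[OF annihilates_shift q] by blast
qed

section \<open>Subdivisions\<close>

definition subdivision_path :: "('a \<times> 'a) list \<Rightarrow> nat list \<Rightarrow> nat \<Rightarrow> ('a + nat \<times> nat) rel" where
  "subdivision_path es ns k =
     {(subdiv_vertex es ns k i, subdiv_vertex es ns k (Suc i)) | i. i \<le> ns ! k}"

text \<open>The part of the graph that stays the same when \<open>ns ! k\<close> varies.\<close>

definition subdivision_core ::
    "'a pair_pre_digraph \<Rightarrow> ('a \<times> 'a) list \<Rightarrow> nat list \<Rightarrow> nat \<Rightarrow> ('a + nat \<times> nat) pair_pre_digraph" where
  "subdivision_core G es ns k = \<lparr>
     pverts = Inl ` pverts G \<union>
       {Inr (j, i) | j i. j < length es \<and> j \<noteq> k \<and> 1 \<le> i \<and> i \<le> ns ! j},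
     parcs = {(Inl u, Inl v) | u v. (u, v) \<in> parcs G \<and> (u, v) \<notin> set es \<and> (v, u) \<notin> set es} \<union>
       symcl (\<Union>j\<in>{..<length es} - {k}. subdivision_path es ns j) \<rparr>"

lemma subdivision_path_update_neq:
  "j \<noteq> k \<Longrightarrow> subdivision_path es (ns[k := n]) j = subdivision_path es ns j"
  by (simp add: subdivision_path_def subdiv_vertex_def)

text \<open>The successor excludes the path without new vertices, whose only arc joins two old
  vertices.\<close>

lemma subdivision_path_update_eq:
  assumes "k < length ns"
  shows "subdivision_path es (ns[k := Suc n]) k =
    {(Inl (fst (es ! k)), Inr (k, 1)), (Inr (k, Suc n), Inl (snd (es ! k)))} \<union>
    {(Inr (k, i), Inr (k, Suc i)) | i. 1 \<le> i \<and> i \<le> n}" (is "?L = ?R")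
proof
  show "?L \<subseteq> ?R"
    using assms by (auto simp: subdivision_path_def subdiv_vertex_def le_Suc_eq)
  show "?R \<subseteq> ?L"
  proof
    fix z assume "z \<in> ?R"
    then consider "z = (Inl (fst (es ! k)), Inr (k, 1))"
      | "z = (Inr (k, Suc n), Inl (snd (es ! k)))"
      | i where "z = (Inr (k, i), Inr (k, Suc i))" "1 \<le> i" "i \<le> n" by blast
    then show "z \<in> ?L"
    proof cases
      case 1
      then show ?thesis using assms unfolding subdivision_path_def
        by (intro CollectI exI[of _ 0]) (simp add: subdiv_vertex_def)
    next
      case 2
      then show ?thesis using assms unfolding subdivision_path_def
        by (intro CollectI exI[of _ "Suc n"]) (simp add: subdiv_vertex_def)
    next
      case (3 i)
      then show ?thesis using assms unfolding subdivision_path_def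
        by (intro CollectI exI[of _ i]) (simp add: subdiv_vertex_def)
    qed
  qed
qed

lemma pverts_subdivide_edges:
  assumes "k < length es" "length ns = length es"
  shows "pverts (subdivide_edges G es (ns[k := n])) =
    pverts (subdivision_core G es ns k) \<union> (\<lambda>i. Inr (k, Suc i)) ` {..<n}"
proof -
  have "(\<lambda>i. Inr (k, Suc i)) ` {..<n} = {Inr (k, i) | i. 1 \<le> i \<and> i \<le> n}"
    by (auto simp: image_iff) (metis Suc_le_D Suc_le_lessD lessThan_iff)
  moreover have "i \<le> ns[k := n] ! j \<longleftrightarrow> (if j = k then i \<le> n else i \<le> ns ! j)" for i j
    using assms by simp
  ultimately show ?thesis
    using assms(1) by (auto simp: subdivide_edges_def subdivision_core_def split: if_splits)
qed

lemma parcs_subdivide_edges: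
  assumes "k < length es" "length ns = length es"
  shows "parcs (subdivide_edges G es (ns[k := n])) =
    parcs (subdivision_core G es ns k) \<union> symcl (subdivision_path es (ns[k := n]) k)"
proof -
  let ?ns = "ns[k := n]"
  have "{(subdiv_vertex es ?ns j i, subdiv_vertex es ?ns j (Suc i)) | j i. j < length es \<and> i \<le> ?ns ! j} =
      (\<Union>j\<in>{..<length es}. subdivision_path es ?ns j)"
    unfolding subdivision_path_def by blast
  also have "{..<length es} = insert k ({..<length es} - {k})"
    using assms(1) by auto
  also have "(\<Union>j\<in>insert k ({..<length es} - {k}). subdivision_path es ?ns j) =
      (\<Union>j\<in>{..<length es} - {k}. subdivision_path es ns j) \<union> subdivision_path es ?ns k"
    by (subst UN_insert) (simp add: subdivision_path_update_neq Un_commute)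
  finally show ?thesis
    by (simp add: subdivide_edges_def subdivision_core_def symcl_def) blast
qed

lemma not_in_parcs_subdivision_core:
  "(Inr (k, i), y) \<notin> parcs (subdivision_core G es ns k)"
  "(y, Inr (k, i)) \<notin> parcs (subdivision_core G es ns k)"
  by (auto simp: subdivision_core_def symcl_def subdivision_path_def subdiv_vertex_def
      split: if_splits)

text \<open>A subdividing path is a chain of one-vertex layers. This layer graph is the same for
  every edge, hence so is the recurrence.\<close>

definition vertex_graph :: "unit pair_pre_digraph" where
  "vertex_graph = \<lparr> pverts = {()}, parcs = {} \<rparr>"

lemma finite_subdivision_core:
  assumes "finite (pverts G)"
  shows "finite (pverts (subdivision_core G es ns k))"
proof -
  have "finite {Inr (j, i) | j i. j < length es \<and> j \<noteq> k \<and> 1 \<le> i \<and> i \<le> ns ! j}"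
    by (rule finite_subset[of _ "Inr ` (SIGMA j:{..<length es}. {..ns ! j})"]) auto
  with assms show ?thesis
    unfolding subdivision_core_def by simp
qed

lemma finite_vertex_graph: "finite (pverts vertex_graph)"
  by (simp add: vertex_graph_def)

text \<open>Seen from the \<open>k\<close>-th path, the rest of the graph is a core. Layer
  \<open>i\<close> is the new vertex \<open>Inr (k, Suc i)\<close>, since new vertices are numbered
  from \<open>1\<close>.\<close>

lemma full_W_subdivide_chain:
  assumes "finite (pverts G)" "k < length es" "length ns = length es"
  shows "full_W (subdivide_edges G es (ns[k := n + 2])) =
    full_W (chain (subdivision_core G es ns k) vertex_graph
      {(Inl (fst (es ! k)), ())} {(Inl (snd (es ! k)), ())} (n + 2))"
proof -
  let ?D = "subdivision_core G es ns k"
  let ?C = "chain ?D vertex_graph {(Inl (fst (es ! k)), ())} {(Inl (snd (es ! k)), ())} (n + 2)"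
  let ?S = "subdivide_edges G es (ns[k := n + 2])"
  let ?\<phi> = "case_sum (\<lambda>x. x) (\<lambda>(_, i). Inr (k, Suc i))"
  have core: "Inr (k, i) \<notin> pverts ?D" for i
    by (auto simp: subdivision_core_def)
  have arcs: "parcs ?S = parcs ?D \<union> symcl (
      {(Inl (fst (es ! k)), Inr (k, 1)), (Inr (k, n + 2), Inl (snd (es ! k)))} \<union>
      {(Inr (k, i), Inr (k, Suc i)) | i. 1 \<le> i \<and> i \<le> n + 1})"
    using parcs_subdivide_edges[OF assms(2,3), of G "n + 2"]
      subdivision_path_update_eq[of k ns es "n + 1"] assms(2,3) by simp
  show ?thesis
  proof (rule full_W_iso[of ?\<phi>])
    show "inj_on ?\<phi> (pverts ?C)"
      using core by (auto simp: chain_def inj_on_def)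
    show "pverts ?S = ?\<phi> ` pverts ?C"
      unfolding pverts_subdivide_edges[OF assms(2,3)]
      by (auto simp: chain_def vertex_graph_def Plus_def image_Un image_image image_iff)
    show "finite (pverts ?C)"
      using finite_subdivision_core[OF assms(1)] by (simp add: chain_def vertex_graph_def)
    fix x y assume xy: "x \<in> pverts ?C" "y \<in> pverts ?C"
    show "(?\<phi> x, ?\<phi> y) \<in> parcs ?S \<longleftrightarrow> (x, y) \<in> parcs ?C"
    proof (cases x; cases y)
      fix u v assume "x = Inl u" "y = Inl v"
      then show ?thesis
        using xy core unfolding arcs by (auto simp: chain_def symcl_def not_in_parcs_subdivision_core)
    next
      fix u q assume "x = Inl u" "y = Inr q"
      then show ?thesis
        using xy core unfolding arcs
        by (cases q) (auto simp: chain_def symcl_def not_in_parcs_subdivision_core)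
    next
      fix u q assume "x = Inr q" "y = Inl u"
      then show ?thesis
        using xy core unfolding arcs
        by (cases q) (auto simp: chain_def symcl_def not_in_parcs_subdivision_core)
    next
      fix p q assume "x = Inr p" "y = Inr q"
      then show ?thesis
        using xy core unfolding arcs
        by (cases p; cases q) (auto simp: chain_def symcl_def vertex_graph_def not_in_parcs_subdivision_core)
    qed
  qed
qed

text \<open>The core changes with \<open>k\<close> and with the fixed lengths, yet one annihilator
  serves all cores, as \<open>rational_fps_compositions\<close> demands.\<close>

lemma rational_fps_GSm:
  assumes "finite (pverts G)"
  shows "rational_fps (full_Xi (family_GSm G es))"
proof -
  obtain q N where q: "q \<noteq> 0" and ann:
      "\<And>K R R'. finite (pverts (K :: ('a + nat \<times> nat) pair_pre_digraph)) \<Longrightarrow>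
        annihilates q N (\<lambda>n. full_W (chain K vertex_graph R R' (n + 2)))"
    using chain_annihilator[of vertex_graph] finite_vertex_graph by blast
  let ?F = "Abs_fps (\<lambda>n. \<Sum>ns | length ns = length es \<and> sum_list ns = n.
    full_W (subdivide_edges G es ns))"
  have "rational_fps ?F"
  proof (rule rational_fps_compositions[OF q])
    fix k and ns :: "nat list" assume k: "k < length es" "length ns = length es"
    then have "annihilates q N (\<lambda>n. full_W (subdivide_edges G es (ns[k := n + 2])))"
      unfolding full_W_subdivide_chain[OF assms k]
      by (intro ann finite_subdivision_core assms)
    then show "annihilates q (N + 2 + degree q) (\<lambda>n. full_W (subdivide_edges G es (ns[k := n])))"
      by (rule annihilates_shift)
  qed
  \<comment> \<open>\<open>full_Xi\<close> starts at index \<open>1\<close>, so the constant term,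
    where no edge receives a new vertex, is removed.\<close>
  then have "rational_fps (?F + fps_of_poly [:- ?F $ 0:])"
    by (intro rational_fps_add rational_fps_of_poly)
  moreover have "full_Xi (family_GSm G es) = ?F + fps_of_poly [:- ?F $ 0:]"
  proof (rule fps_ext)
    fix n
    show "full_Xi (family_GSm G es) $ n = (?F + fps_of_poly [:- ?F $ 0:]) $ n"
      by (cases n) (simp_all add: full_Xi_def family_GSm_def fps_of_poly_const sum_unfold_sum_mset
          multiset.map_comp o_def)
  qed
  ultimately show ?thesis by simp
qed

lemma family_GS1_eq: "family_GS1 G e = family_GSm G [e]"
proof
  fix n :: nat
  have "{ns :: nat list. length ns = 1 \<and> sum_list ns = n} = {[n]}"
    by (auto simp: length_Suc_conv)
  then show "family_GS1 G e n = family_GSm G [e] n"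
    by (simp add: family_GS1_def family_GSm_def)
qed

theorem theorem4p12:
  fixes G :: "'a pair_pre_digraph"
  assumes "pair_graph G"
  shows "rational_fps (full_Xi (family_GC G)) \<and>
    (\<forall>H. pair_graph H \<and> subgraph (with_proj H) (with_proj G) \<longrightarrow>
      rational_fps (full_Xi (family_GX G H))) \<and>
    rational_fps (full_Xi (family_GT G)) \<and>
    (\<forall>H. pair_graph H \<and> subgraph (with_proj H) (with_proj G) \<longrightarrow>
      rational_fps (full_Xi (family_GE G H))) \<and>
    (\<forall>e \<in> parcs G. rational_fps (full_Xi (family_GS1 G e))) \<and>
    (\<forall>es. edge_enumeration G es \<longrightarrow> rational_fps (full_Xi (family_GSm G es)))"
proof -
  interpret pair_graph G by fact
  \<comment> \<open>Only agreement from index \<open>3\<close> on is asked for, so this covers both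
    the products and the attached paths.\<close>
  have path: "rational_fps (full_Xi \<G>)"
    if "pair_graph H" "subgraph (with_proj H) (with_proj G)"
      "\<And>n. \<G> (n + 3) = {#attach G H (path_graph (n + 3))#}" for H \<G>
    using assms that(1,2) _ _ that(3)
    by (rule rational_fps_attach[where cyclic = False]) (auto simp: path_graph_def)
  have cycle: "rational_fps (full_Xi \<G>)"
    if "pair_graph H" "subgraph (with_proj H) (with_proj G)"
      "\<And>n. \<G> (n + 3) = {#attach G H (cycle_graph (n + 3))#}" for H \<G>
    using assms that(1,2) _ _ that(3)
    by (rule rational_fps_attach[where cyclic = True])
      (use cycle_graph_arcs in \<open>auto simp: cycle_graph_def\<close>)
  show ?thesis
  proof (intro conjI allI impI ballI)
    \<comment> \<open>The product is the case \<open>H = G\<close>.\<close>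
    show "rational_fps (full_Xi (family_GC G))"
      using assms subgraph_refl
      by (rule path) (simp add: family_GC_def box_product_eq_attach[OF assms] path_graph_def)
    show "rational_fps (full_Xi (family_GT G))"
      using assms subgraph_refl
      by (rule cycle) (simp add: family_GT_def box_product_eq_attach[OF assms] cycle_graph_def)
  next
    fix H assume "pair_graph H \<and> subgraph (with_proj H) (with_proj G)"
    then show "rational_fps (full_Xi (family_GX G H))"
      by (intro path[of H]) (auto simp: family_GX_def graph_X_def attach_def)
  next
    fix H assume "pair_graph H \<and> subgraph (with_proj H) (with_proj G)"
    then show "rational_fps (full_Xi (family_GE G H))"
      by (intro cycle[of H]) (auto simp: family_GE_def graph_E_def attach_def)
  qed (simp_all add: family_GS1_eq rational_fps_GSm)
qed

end
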